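(* Let $(M,g,\nabla^0)$ be a Hessian manifold. If $M$ is flat (i.e. the Riemannian curvature of $g$ vanishes), then the Associativity Equation is satisfied: in affine coordinates with local potential $\Phi$, for all $a,b,c,d$, $$\sum_{e,f}\partial_a\partial_b\partial_e\Phi\; g^{ef}\;\partial_f\partial_c\partial_d\Phi=\sum_{e,f}\partial_b\partial_c\partial_e\Phi\; g^{ef}\;\partial_f\partial_a\partial_d\Phi.$$
   Context: A Hessian manifold $(M,g,\nabla^0)$ is a smooth manifold $M$ with a flat torsionless affine connection $\nabla^0$ and a Riemannian metric $g$ which, in affine local coordinates $(x^1,\dots,x^n)$ (i.e. $\nabla^0(dx^i)=0$), is expressed as $g=\sum_{i,j}\frac{\partial^2\Phi}{\partial x^i\partial x^j}dx^idx^j$ for a local smooth real-valued function $\Phi$ (the potential). Here $\partial_a=\partial/\partial x^a$ and $[g^{ef}]=[g_{ef}]^{-1}$. *)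

theory Defs
  imports "HOL-Analysis.Analysis"
begin

section \<open>Smooth functions on open subsets of Euclidean space\<close>

definition partial_deriv :: "'n::finite \<Rightarrow> (real ^ 'n \<Rightarrow> real) \<Rightarrow> real ^ 'n \<Rightarrow> real" where
  "partial_deriv i f x = deriv (\<lambda>t. f (x + t *\<^sub>R axis i 1)) 0"

text \<open>The following two predicates are only meant for open \<open>S\<close>.\<close>

fun Ck_on :: "nat \<Rightarrow> (real ^ 'n::finite) set \<Rightarrow> (real ^ 'n \<Rightarrow> real) \<Rightarrow> bool" where
  "Ck_on 0 S f \<longleftrightarrow> continuous_on S f"
| "Ck_on (Suc k) S f \<longleftrightarrow> f differentiable_on S \<and> (\<forall>i. Ck_on k S (partial_deriv i f))"

definition smooth_on :: "(real ^ 'n::finite) set \<Rightarrow> (real ^ 'n \<Rightarrow> real) \<Rightarrow> bool" where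
  "smooth_on S f \<longleftrightarrow> (\<forall>k. Ck_on k S f)"


section \<open>Smooth manifolds\<close>

text \<open>A chart is a domain together with a coordinate map; only the values of the map on the
  domain are relevant. The dimension of the manifold is \<open>CARD('n)\<close>.\<close>

type_synonym ('a, 'n) chart = "'a set \<times> ('a \<Rightarrow> real ^ 'n)"

definition chart_image :: "('a, 'n::finite) chart \<Rightarrow> (real ^ 'n) set" where
  "chart_image c = snd c ` fst c"

definition is_chart :: "'a topology \<Rightarrow> ('a, 'n::finite) chart \<Rightarrow> bool" where
  "is_chart M c \<longleftrightarrow> openin M (fst c) \<and> open (chart_image c) \<and>
     homeomorphic_map (subtopology M (fst c)) (top_of_set (chart_image c)) (snd c)"

definition transition :: "('a, 'n::finite) chart \<Rightarrow> ('a, 'n) chart \<Rightarrow> real ^ 'n \<Rightarrow> real ^ 'n" where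
  "transition c d = snd d \<circ> the_inv_into (fst c) (snd c)"

definition transition_domain :: "('a, 'n::finite) chart \<Rightarrow> ('a, 'n) chart \<Rightarrow> (real ^ 'n) set" where
  "transition_domain c d = snd c ` (fst c \<inter> fst d)"

definition smoothly_compatible :: "('a, 'n::finite) chart \<Rightarrow> ('a, 'n) chart \<Rightarrow> bool" where
  "smoothly_compatible c d \<longleftrightarrow>
     (\<forall>i. smooth_on (transition_domain c d) (\<lambda>x. transition c d x $ i)) \<and>
     (\<forall>i. smooth_on (transition_domain d c) (\<lambda>x. transition d c x $ i))"

text \<open>The set \<open>A\<close> is a maximal smooth atlas, so that it contains every smooth
  local coordinate system.\<close>

definition smooth_manifold :: "'a topology \<Rightarrow> ('a, 'n::finite) chart set \<Rightarrow> bool" where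
  "smooth_manifold M A \<longleftrightarrow>
     Hausdorff_space M \<and> second_countable M \<and>
     (\<forall>c\<in>A. is_chart M c) \<and>
     (\<Union>c\<in>A. fst c) = topspace M \<and>
     (\<forall>c\<in>A. \<forall>d\<in>A. smoothly_compatible c d) \<and>
     (\<forall>c. is_chart M c \<and> (\<forall>d\<in>A. smoothly_compatible c d) \<longrightarrow> c \<in> A)"


section \<open>Affine connections\<close>

text \<open>A connection on the tangent bundle is given by its Christoffel symbols in all charts.
  In the chart \<open>c\<close> with coordinates \<open>x\<close>, the covariant derivative of the \<open>j\<close>-th coordinate
  vector field along the \<open>i\<close>-th one has \<open>k\<close>-th component \<open>\<Gamma> c k i j x\<close>.\<close>

type_synonym 'n christoffel = "'n \<Rightarrow> 'n \<Rightarrow> 'n \<Rightarrow> real ^ 'n \<Rightarrow> real"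

definition affine_connection ::
  "('a, 'n::finite) chart set \<Rightarrow> (('a, 'n) chart \<Rightarrow> 'n christoffel) \<Rightarrow> bool" where
  "affine_connection A \<Gamma> \<longleftrightarrow>
     (\<forall>c\<in>A. \<forall>k i j. smooth_on (chart_image c) (\<Gamma> c k i j)) \<and>
     (\<forall>c\<in>A. \<forall>d\<in>A. \<forall>x\<in>transition_domain c d. \<forall>l i j.
        (let \<tau> = (\<lambda>m y. transition c d y $ m) in
          (\<Sum>k\<in>UNIV. partial_deriv k (\<tau> l) x * \<Gamma> c k i j x) =
          partial_deriv i (partial_deriv j (\<tau> l)) x +
          (\<Sum>p\<in>UNIV. \<Sum>q\<in>UNIV.
             partial_deriv i (\<tau> p) x * partial_deriv j (\<tau> q) x * \<Gamma> d l p q (transition c d x))))"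

definition torsionless ::
  "('a, 'n::finite) chart set \<Rightarrow> (('a, 'n) chart \<Rightarrow> 'n christoffel) \<Rightarrow> bool" where
  "torsionless A \<Gamma> \<longleftrightarrow> (\<forall>c\<in>A. \<forall>x\<in>chart_image c. \<forall>k i j. \<Gamma> c k i j x = \<Gamma> c k j i x)"

text \<open>With \<open>D i\<close> the covariant derivative along the \<open>i\<close>-th coordinate vector field \<open>\<partial> i\<close>,
  \<open>curvature G l k i j\<close> is the \<open>l\<close>-th component of \<open>D i (D j (\<partial> k)) - D j (D i (\<partial> k))\<close>.\<close>

definition curvature :: "'n::finite christoffel \<Rightarrow> 'n \<Rightarrow> 'n \<Rightarrow> 'n \<Rightarrow> 'n \<Rightarrow> real ^ 'n \<Rightarrow> real" where
  "curvature G l k i j x =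
     partial_deriv i (G l j k) x - partial_deriv j (G l i k) x +
     (\<Sum>m\<in>UNIV. G l i m x * G m j k x - G l j m x * G m i k x)"

definition flat_connection ::
  "('a, 'n::finite) chart set \<Rightarrow> (('a, 'n) chart \<Rightarrow> 'n christoffel) \<Rightarrow> bool" where
  "flat_connection A \<Gamma> \<longleftrightarrow>
     (\<forall>c\<in>A. \<forall>x\<in>chart_image c. \<forall>l k i j. curvature (\<Gamma> c) l k i j x = 0)"

text \<open>Component \<open>(j, k)\<close> of the covariant derivative of the 1-form with components \<open>\<alpha> k\<close>.\<close>

definition covariant_deriv_form ::
  "'n::finite christoffel \<Rightarrow> ('n \<Rightarrow> real ^ 'n \<Rightarrow> real) \<Rightarrow> 'n \<Rightarrow> 'n \<Rightarrow> real ^ 'n \<Rightarrow> real" where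
  "covariant_deriv_form G \<alpha> j k x =
     partial_deriv j (\<alpha> k) x - (\<Sum>m\<in>UNIV. G m j k x * \<alpha> m x)"

definition differential :: "(real ^ 'n::finite \<Rightarrow> real) \<Rightarrow> 'n \<Rightarrow> real ^ 'n \<Rightarrow> real" where
  "differential f k = partial_deriv k f"

text \<open>All coordinate differentials are parallel.\<close>

definition affine_coordinates ::
  "(('a, 'n) chart \<Rightarrow> 'n christoffel) \<Rightarrow> ('a, 'n::finite) chart \<Rightarrow> bool" where
  "affine_coordinates \<Gamma> c \<longleftrightarrow>
     (\<forall>i. \<forall>x\<in>chart_image c. \<forall>j k.
        covariant_deriv_form (\<Gamma> c) (differential (\<lambda>y. y $ i)) j k x = 0)"


section \<open>Riemannian metrics\<close>

text \<open>A metric is given by its component matrix in all charts.\<close>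

definition riemannian_metric ::
  "('a, 'n::finite) chart set \<Rightarrow> (('a, 'n) chart \<Rightarrow> real ^ 'n \<Rightarrow> real ^ 'n ^ 'n) \<Rightarrow> bool" where
  "riemannian_metric A g \<longleftrightarrow>
     (\<forall>c\<in>A. \<forall>i j. smooth_on (chart_image c) (\<lambda>x. g c x $ i $ j)) \<and>
     (\<forall>c\<in>A. \<forall>x\<in>chart_image c.
        transpose (g c x) = g c x \<and> (\<forall>v. v \<noteq> 0 \<longrightarrow> v \<bullet> (g c x *v v) > 0)) \<and>
     (\<forall>c\<in>A. \<forall>d\<in>A. \<forall>x\<in>transition_domain c d. \<forall>i j.
        (let \<tau> = (\<lambda>m y. transition c d y $ m) in
          g c x $ i $ j =
          (\<Sum>k\<in>UNIV. \<Sum>l\<in>UNIV.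
             partial_deriv i (\<tau> k) x * partial_deriv j (\<tau> l) x * g d (transition c d x) $ k $ l)))"

definition levi_civita :: "(real ^ 'n \<Rightarrow> real ^ 'n ^ 'n) \<Rightarrow> 'n::finite christoffel" where
  "levi_civita h k i j x =
     (1/2) * (\<Sum>l\<in>UNIV. matrix_inv (h x) $ k $ l *
        (partial_deriv i (\<lambda>y. h y $ j $ l) x +
         partial_deriv j (\<lambda>y. h y $ i $ l) x -
         partial_deriv l (\<lambda>y. h y $ i $ j) x))"

definition riemannian_flat ::
  "('a, 'n::finite) chart set \<Rightarrow> (('a, 'n) chart \<Rightarrow> real ^ 'n \<Rightarrow> real ^ 'n ^ 'n) \<Rightarrow> bool" where
  "riemannian_flat A g \<longleftrightarrow> flat_connection A (\<lambda>c. levi_civita (g c))"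


section \<open>Hessian manifolds\<close>

definition local_potential ::
  "(('a, 'n) chart \<Rightarrow> real ^ 'n \<Rightarrow> real ^ 'n ^ 'n) \<Rightarrow> ('a, 'n::finite) chart \<Rightarrow>
   (real ^ 'n) set \<Rightarrow> (real ^ 'n \<Rightarrow> real) \<Rightarrow> bool" where
  "local_potential g c V \<Phi> \<longleftrightarrow>
     open V \<and> V \<subseteq> chart_image c \<and> smooth_on V \<Phi> \<and>
     (\<forall>x\<in>V. \<forall>i j. g c x $ i $ j = partial_deriv i (partial_deriv j \<Phi>) x)"

definition hessian_manifold ::
  "'a topology \<Rightarrow> ('a, 'n::finite) chart set \<Rightarrow>
   (('a, 'n) chart \<Rightarrow> real ^ 'n \<Rightarrow> real ^ 'n ^ 'n) \<Rightarrow> (('a, 'n) chart \<Rightarrow> 'n christoffel) \<Rightarrow> bool" where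
  "hessian_manifold M A g \<Gamma> \<longleftrightarrow>
     smooth_manifold M A \<and>
     affine_connection A \<Gamma> \<and> flat_connection A \<Gamma> \<and> torsionless A \<Gamma> \<and>
     riemannian_metric A g \<and>
     (\<forall>c\<in>A. affine_coordinates \<Gamma> c \<longrightarrow>
        (\<forall>x\<in>chart_image c. \<exists>V \<Phi>. x \<in> V \<and> local_potential g c V \<Phi>))"

end

(* In affine coordinates the third derivatives T of the potential are totally symmetric, so the
   lowered Christoffel symbols of the Hessian metric g are T / 2. Differentiating
   sum_l g_pl Gamma^l_jk = T_jkp / 2 expresses the lowered curvature without derivatives of the
   inverse metric; the fourth derivatives cancel because partial derivatives commute, and what
   remains is the difference of the two sides of the Associativity Equation, divided by 4. *)

theory Submission
  imports Defs
begin

section \<open>Partial derivatives and smooth functions\<close>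

text \<open>\<open>deriv\<close> is a choice operator, so \<open>partial_deriv\<close> is a genuine
  derivative only once differentiability is known. The parameter \<open>s\<close> is arbitrary
  because the mean value theorem needs derivatives all along a segment.\<close>

lemma has_real_derivative_partial_deriv:
  fixes f :: "real ^ 'n::finite \<Rightarrow> real"
  assumes "f differentiable at (y + s *\<^sub>R axis i 1)"
  shows "((\<lambda>t. f (y + t *\<^sub>R axis i 1)) has_real_derivative
    partial_deriv i f (y + s *\<^sub>R axis i 1)) (at s)"
proof -
  define e :: "real ^ 'n" where "e = axis i 1"
  obtain L where L: "(f has_derivative L) (at (y + s *\<^sub>R e))"
    using assms by (auto simp: differentiable_def e_def)
  \<comment> \<open>Serves two parametrisations through the same point: based at the point itself
    with \<open>r = 0\<close>, which identifies \<open>L e\<close> with the partial derivative, and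
    based at \<open>y\<close> with \<open>r = s\<close>.\<close>
  have line: "((\<lambda>t. f (z + t *\<^sub>R e)) has_real_derivative L e) (at r)"
    if "z + r *\<^sub>R e = y + s *\<^sub>R e" for z r
  proof -
    have "((\<lambda>t. z + t *\<^sub>R e) has_derivative (\<lambda>t. t *\<^sub>R e)) (at r)"
      by (auto intro!: derivative_eq_intros)
    moreover have "(f has_derivative L) (at (z + r *\<^sub>R e))"
      using L that by simp
    ultimately have "((\<lambda>t. f (z + t *\<^sub>R e)) has_derivative (\<lambda>t. L (t *\<^sub>R e))) (at r)"
      by (rule has_derivative_compose)
    moreover have "(\<lambda>t. L (t *\<^sub>R e)) = (*) (L e)"
      using linear_scale[OF has_derivative_linear[OF L]] by (simp add: fun_eq_iff mult.commute)
    ultimately show ?thesis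
      by (simp add: has_field_derivative_def)
  qed
  have "partial_deriv i f (y + s *\<^sub>R e) = L e"
    using DERIV_imp_deriv[OF line[of "y + s *\<^sub>R e" 0]] by (simp add: partial_deriv_def e_def)
  with line[of y s] show ?thesis
    by (simp add: e_def)
qed

lemma eventually_line_in_open:
  fixes x e :: "'a::real_normed_vector"
  assumes "open V" "x \<in> V"
  shows "\<forall>\<^sub>F t in nhds 0. x + t *\<^sub>R e \<in> V"
proof -
  have "open ((\<lambda>t. x + t *\<^sub>R e) -` V)"
    by (intro open_vimage assms continuous_intros)
  then show ?thesis
    using eventually_nhds_in_open[of "(\<lambda>t. x + t *\<^sub>R e) -` V" 0] assms by simp
qed

text \<open>A short piece of the coordinate line through \<open>x\<close> stays in \<open>V\<close>,
  and \<open>deriv\<close> sees only values near 0. Identities valid only on \<open>V\<close> can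
  thus be differentiated.\<close>

lemma partial_deriv_cong_open:
  assumes "open V" "x \<in> V" and eq: "\<And>y. y \<in> V \<Longrightarrow> f y = h y"
  shows "partial_deriv i f x = partial_deriv i h x"
proof -
  have "\<forall>\<^sub>F t in nhds 0. f (x + t *\<^sub>R axis i 1) = h (x + t *\<^sub>R axis i 1)"
    using eventually_line_in_open[OF assms(1,2)] by eventually_elim (rule eq)
  then show ?thesis
    unfolding partial_deriv_def by (intro deriv_cong_ev) auto
qed

lemma smooth_on_partial_deriv: "smooth_on S f \<Longrightarrow> smooth_on S (partial_deriv i f)"
  unfolding smooth_on_def by (metis Ck_on.simps(2))

lemma smooth_on_imp_continuous_on: "smooth_on S f \<Longrightarrow> continuous_on S f"
  unfolding smooth_on_def by (metis Ck_on.simps(1))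

lemma smooth_on_imp_differentiable_at:
  assumes "smooth_on S f" "open S" "x \<in> S"
  shows "f differentiable at x"
proof -
  have "f differentiable_on S"
    using assms(1) unfolding smooth_on_def by (metis Ck_on.simps(2))
  with assms(2,3) show ?thesis
    by (simp add: differentiable_on_eq_differentiable_at)
qed

section \<open>Symmetry of second partial derivatives\<close>

text \<open>The mean value theorem is applied first in direction \<open>i\<close>, then in direction
  \<open>j\<close>. Exchanging \<open>i\<close> and \<open>j\<close> preserves the second difference
  but reverses the order of the mixed derivative.\<close>

lemma second_difference_mean_value:
  fixes f :: "real ^ 'n::finite \<Rightarrow> real"
  assumes smooth: "smooth_on V f" and V: "open V" and h: "h > 0"
    and square: "\<And>s t. 0 \<le> s \<Longrightarrow> s \<le> h \<Longrightarrow> 0 \<le> t \<Longrightarrow> t \<le> h \<Longrightarrow>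
      x + s *\<^sub>R axis i 1 + t *\<^sub>R axis j 1 \<in> V"
  obtains s t where "0 \<le> s" "s \<le> h" "0 \<le> t" "t \<le> h"
    "f (x + h *\<^sub>R axis i 1 + h *\<^sub>R axis j 1) - f (x + h *\<^sub>R axis i 1) - f (x + h *\<^sub>R axis j 1) + f x
      = h\<^sup>2 * partial_deriv j (partial_deriv i f) (x + s *\<^sub>R axis i 1 + t *\<^sub>R axis j 1)"
proof -
  define u v :: "real ^ 'n" where "u = axis i 1" and "v = axis j 1"
  have di: "((\<lambda>s. f (x + t *\<^sub>R v + s *\<^sub>R u)) has_real_derivative
      partial_deriv i f (x + s *\<^sub>R u + t *\<^sub>R v)) (at s)"
    if "0 \<le> s" "s \<le> h" "0 \<le> t" "t \<le> h" for s t
    using has_real_derivative_partial_deriv[of f "x + t *\<^sub>R v" s i]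
      smooth_on_imp_differentiable_at[OF smooth V square[OF that]]
    by (simp add: u_def v_def add_ac)
  have dj: "((\<lambda>t. partial_deriv i f (x + s *\<^sub>R u + t *\<^sub>R v)) has_real_derivative
      partial_deriv j (partial_deriv i f) (x + s *\<^sub>R u + t *\<^sub>R v)) (at t)"
    if "0 \<le> s" "s \<le> h" "0 \<le> t" "t \<le> h" for s t
    using has_real_derivative_partial_deriv[of "partial_deriv i f" "x + s *\<^sub>R u" t j]
      smooth_on_imp_differentiable_at[OF smooth_on_partial_deriv[OF smooth] V square[OF that]]
    by (simp add: u_def v_def)
  \<comment> \<open>The increment across the square in direction \<open>v\<close>, so that
    \<open>F h - F 0\<close> is the second difference. The summand \<open>0 *\<^sub>R v\<close>
    gives both terms the shape of \<open>di\<close> and makes the derivative of \<open>F\<close> an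
    increment to which \<open>dj\<close> applies.\<close>
  define F where "F s = f (x + h *\<^sub>R v + s *\<^sub>R u) - f (x + 0 *\<^sub>R v + s *\<^sub>R u)" for s
  have dF: "(F has_real_derivative
      partial_deriv i f (x + s *\<^sub>R u + h *\<^sub>R v) - partial_deriv i f (x + s *\<^sub>R u + 0 *\<^sub>R v)) (at s)"
    if "0 \<le> s" "s \<le> h" for s
    unfolding F_def using h that by (intro DERIV_diff di) auto
  obtain s where s: "0 < s" "s < h" and Fs: "F h - F 0 = (h - 0) *
      (partial_deriv i f (x + s *\<^sub>R u + h *\<^sub>R v) - partial_deriv i f (x + s *\<^sub>R u + 0 *\<^sub>R v))"
    using MVT2[OF h dF] by blast
  obtain t where t: "0 < t" "t < h" and Gt:
    "partial_deriv i f (x + s *\<^sub>R u + h *\<^sub>R v) - partial_deriv i f (x + s *\<^sub>R u + 0 *\<^sub>R v)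
      = (h - 0) * partial_deriv j (partial_deriv i f) (x + s *\<^sub>R u + t *\<^sub>R v)"
    using MVT2[OF h dj[of s]] s by auto
  have "F h - F 0 = f (x + h *\<^sub>R u + h *\<^sub>R v) - f (x + h *\<^sub>R u) - f (x + h *\<^sub>R v) + f x"
    by (simp add: F_def add_ac)
  then show thesis
    using that[of s t] s t Fs Gt by (simp add: u_def v_def power2_eq_square)
qed

text \<open>One second difference over a small square equals \<open>h\<^sup>2\<close> times either
  mixed derivative, each at some point of the square. Continuity at \<open>x\<close> then excludes a
  gap between the two.\<close>

lemma partial_deriv_commute:
  fixes f :: "real ^ 'n::finite \<Rightarrow> real"
  assumes smooth: "smooth_on V f" and V: "open V" and x: "x \<in> V"
  shows "partial_deriv i (partial_deriv j f) x = partial_deriv j (partial_deriv i f) x"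
proof (rule ccontr)
  let ?P = "\<lambda>i j. partial_deriv i (partial_deriv j f)"
  assume ne: "?P i j x \<noteq> ?P j i x"
  \<comment> \<open>Half the gap: a common value within \<open>d\<close> of both mixed derivatives
    at \<open>x\<close> contradicts the triangle inequality.\<close>
  define d where "d = \<bar>?P i j x - ?P j i x\<bar> / 2"
  have "d > 0"
    using ne by (simp add: d_def)
  have "\<exists>\<delta>>0. \<forall>y. dist y x < \<delta> \<longrightarrow> y \<in> V \<and> dist (?P k l y) (?P k l x) < d" for k l
  proof -
    have "isCont (?P k l) x"
      using smooth_on_imp_continuous_on[OF smooth_on_partial_deriv[OF smooth_on_partial_deriv[OF smooth]]] V x
      by (auto simp: continuous_on_eq_continuous_at)
    then have "\<forall>\<^sub>F y in nhds x. dist (?P k l y) (?P k l x) < d"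
      using \<open>d > 0\<close> tendsto_at_iff_tendsto_nhds tendstoD unfolding isCont_def by fastforce
    moreover have "\<forall>\<^sub>F y in nhds x. y \<in> V"
      using V x by (rule eventually_nhds_in_open)
    ultimately have "\<forall>\<^sub>F y in nhds x. y \<in> V \<and> dist (?P k l y) (?P k l x) < d"
      by (simp add: eventually_conj_iff)
    then show ?thesis
      by (simp add: eventually_nhds_metric)
  qed
  then obtain \<delta>1 \<delta>2 where \<delta>: "\<delta>1 > 0" "\<delta>2 > 0"
    "\<And>y. dist y x < \<delta>1 \<Longrightarrow> y \<in> V \<and> dist (?P i j y) (?P i j x) < d"
    "\<And>y. dist y x < \<delta>2 \<Longrightarrow> y \<in> V \<and> dist (?P j i y) (?P j i x) < d"
    by metis
  \<comment> \<open>Points of the square are at distance at most \<open>2 * h\<close> from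
    \<open>x\<close>, which is two thirds of the smaller radius.\<close>
  define h where "h = min \<delta>1 \<delta>2 / 3"
  have "h > 0"
    using \<delta> by (simp add: h_def)
  have near: "dist (x + s *\<^sub>R axis k 1 + t *\<^sub>R axis l 1) x < min \<delta>1 \<delta>2"
    if "0 \<le> s" "s \<le> h" "0 \<le> t" "t \<le> h" for s t and k l :: 'n
  proof -
    have "dist (x + s *\<^sub>R axis k 1 + t *\<^sub>R axis l 1) x
        \<le> norm (s *\<^sub>R (axis k 1 :: real ^ 'n)) + norm (t *\<^sub>R (axis l 1 :: real ^ 'n))"
      unfolding dist_norm using norm_triangle_ineq by (metis add.assoc add_diff_cancel_left')
    also have "\<dots> \<le> 2 * h"
      using that by simp
    also have "\<dots> < min \<delta>1 \<delta>2"
      using \<open>h > 0\<close> unfolding h_def by linarith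
    finally show ?thesis .
  qed
  have square: "x + s *\<^sub>R axis k 1 + t *\<^sub>R axis l 1 \<in> V"
    if "0 \<le> s" "s \<le> h" "0 \<le> t" "t \<le> h" for s t and k l :: 'n
    using near[OF that] \<delta>(3) by simp
  let ?D = "f (x + h *\<^sub>R axis i 1 + h *\<^sub>R axis j 1) - f (x + h *\<^sub>R axis i 1) - f (x + h *\<^sub>R axis j 1) + f x"
  obtain s t where st: "0 \<le> s" "s \<le> h" "0 \<le> t" "t \<le> h"
    and 1: "?D = h\<^sup>2 * ?P j i (x + s *\<^sub>R axis i 1 + t *\<^sub>R axis j 1)"
    by (rule second_difference_mean_value[where i = i and j = j, OF smooth V \<open>h > 0\<close> square])
  obtain s' t' where st': "0 \<le> s'" "s' \<le> h" "0 \<le> t'" "t' \<le> h"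
    and "f (x + h *\<^sub>R axis j 1 + h *\<^sub>R axis i 1) - f (x + h *\<^sub>R axis j 1) - f (x + h *\<^sub>R axis i 1) + f x
      = h\<^sup>2 * ?P i j (x + s' *\<^sub>R axis j 1 + t' *\<^sub>R axis i 1)"
    by (rule second_difference_mean_value[where i = j and j = i, OF smooth V \<open>h > 0\<close> square])
  then have 2: "?D = h\<^sup>2 * ?P i j (x + s' *\<^sub>R axis j 1 + t' *\<^sub>R axis i 1)"
    by (simp add: algebra_simps)
  have "?P j i (x + s *\<^sub>R axis i 1 + t *\<^sub>R axis j 1) = ?P i j (x + s' *\<^sub>R axis j 1 + t' *\<^sub>R axis i 1)"
    using 1 2 \<open>h > 0\<close> by simp
  moreover have "dist (?P j i (x + s *\<^sub>R axis i 1 + t *\<^sub>R axis j 1)) (?P j i x) < d"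
    using near[OF st] \<delta>(4) by simp
  moreover have "dist (?P i j (x + s' *\<^sub>R axis j 1 + t' *\<^sub>R axis i 1)) (?P i j x) < d"
    using near[OF st'] \<delta>(3) by simp
  ultimately show False
    using \<open>d > 0\<close> unfolding d_def dist_real_def by (smt (verit) field_sum_of_halves)
qed

section \<open>Differentiability of the matrix inverse\<close>

lemma matrix_mult_matrix_inv:
  assumes "invertible A"
  shows "A ** matrix_inv A = mat 1"
proof -
  have "A ** matrix_inv A = mat 1 \<and> matrix_inv A ** A = mat 1"
    using assms unfolding invertible_def matrix_inv_def by (rule someI_ex)
  then show ?thesis ..
qed

text \<open>Column \<open>l\<close> of the inverse solves the linear system with right-hand side
  \<open>axis l 1\<close>. Cramer's rule turns its entries into quotients of determinants, which are
  easy to differentiate.\<close>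

lemma matrix_inv_cramer:
  fixes A :: "'a::field ^ 'n ^ 'n"
  assumes "invertible A"
  shows "matrix_inv A $ k $ l =
    det (\<chi> i j. if j = k then axis l 1 $ i else A $ i $ j) / det A"
proof -
  have "A *v (matrix_inv A *v axis l 1) = axis l 1"
    using matrix_mult_matrix_inv[OF assms] by (simp add: matrix_vector_mul_assoc)
  then have "matrix_inv A *v axis l 1 =
      (\<chi> k. det (\<chi> i j. if j = k then axis l 1 $ i else A $ i $ j) / det A)"
    using cramer[of A] assms by (simp add: invertible_det_nz)
  moreover have "(matrix_inv A *v axis l 1) $ k = matrix_inv A $ k $ l"
    by (simp add: matrix_vector_mult_def axis_def if_distrib cong: if_cong)
  ultimately show ?thesis
    by simp
qed

lemma field_differentiable_cong_ev:
  assumes "\<forall>\<^sub>F t in nhds s. f t = h t"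
  shows "f field_differentiable at s \<longleftrightarrow> h field_differentiable at s"
  unfolding field_differentiable_def using DERIV_cong_ev[OF refl assms refl] by blast

lemma field_differentiable_det:
  fixes B :: "real \<Rightarrow> real ^ 'n ^ 'n"
  assumes "\<And>i j. (\<lambda>t. B t $ i $ j) field_differentiable at s"
  shows "(\<lambda>t. det (B t)) field_differentiable at s"
proof -
  have "\<exists>D. ((\<lambda>t. \<Prod>i\<in>UNIV. B t $ i $ p i) has_field_derivative D) (at s)" for p
    using has_field_derivative_prod[of UNIV "\<lambda>i t. B t $ i $ p i", OF field_differentiable_derivI[OF assms]]
    by blast
  then show ?thesis
    unfolding det_def
    by (intro field_differentiable_sum field_differentiable_mult field_differentiable_const)
       (auto simp: field_differentiable_def)
qed

text \<open>Cramer's rule describes the inverse only at invertible matrices; invertibility near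
  \<open>s\<close> carries differentiability over from the quotient and keeps the denominator
  nonzero.\<close>

lemma field_differentiable_matrix_inv:
  fixes B :: "real \<Rightarrow> real ^ 'n ^ 'n"
  assumes B: "\<And>i j. (\<lambda>t. B t $ i $ j) field_differentiable at s"
    and inv: "\<forall>\<^sub>F t in nhds s. invertible (B t)"
  shows "(\<lambda>t. matrix_inv (B t) $ k $ l) field_differentiable at s"
proof -
  have "det (B s) \<noteq> 0"
    using eventually_nhds_x_imp_x[OF inv] by (simp add: invertible_det_nz)
  \<comment> \<open>The replaced column is constant in \<open>t\<close>; the other entries are those
    of \<open>B\<close>.\<close>
  moreover have "(\<lambda>t. (\<chi> i j. if j = k then axis l 1 $ i else B t $ i $ j) $ i $ j)
      field_differentiable at s" for i j
    using B by (cases "j = k") auto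
  ultimately have "(\<lambda>t. det (\<chi> i j. if j = k then axis l 1 $ i else B t $ i $ j) / det (B t))
      field_differentiable at s"
    using B by (intro field_differentiable_divide field_differentiable_det)
  moreover have "\<forall>\<^sub>F t in nhds s. matrix_inv (B t) $ k $ l =
      det (\<chi> i j. if j = k then axis l 1 $ i else B t $ i $ j) / det (B t)"
    using inv by eventually_elim (rule matrix_inv_cramer)
  ultimately show ?thesis
    by (simp add: field_differentiable_cong_ev)
qed

text \<open>A nonzero kernel vector \<open>v\<close> would give
  \<open>v \<bullet> (A *v v) = 0\<close>.\<close>

lemma positive_definite_invertible:
  fixes A :: "real ^ 'n ^ 'n"
  assumes "\<And>v. v \<noteq> 0 \<Longrightarrow> v \<bullet> (A *v v) > 0"
  shows "invertible A"
  using assms invertible_left_inverse matrix_left_invertible_ker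
  by (metis inner_zero_right less_irrefl)

section \<open>Curvature of a Hessian metric in one chart\<close>

text \<open>The matrix \<open>h\<close> is kept apart from the Hessian of \<open>\<Phi>\<close>
  because the two agree only on \<open>V\<close>. Invertibility is what the calculation takes from
  positive definiteness.\<close>

locale hessian_potential =
  fixes V :: "(real ^ 'n::finite) set" and \<Phi> :: "real ^ 'n \<Rightarrow> real"
    and h :: "real ^ 'n \<Rightarrow> real ^ 'n ^ 'n"
  assumes open_domain: "open V"
    and smooth: "smooth_on V \<Phi>"
    and hessian: "y \<in> V \<Longrightarrow> h y $ i $ j = partial_deriv i (partial_deriv j \<Phi>) y"
    and invertible_hessian: "y \<in> V \<Longrightarrow> invertible (h y)"
begin

abbreviation T :: "'n \<Rightarrow> 'n \<Rightarrow> 'n \<Rightarrow> real ^ 'n \<Rightarrow> real" where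
  "T i j k \<equiv> partial_deriv i (partial_deriv j (partial_deriv k \<Phi>))"

text \<open>These adjacent transpositions generate all permutations of the indices. The first is
  symmetry of second derivatives for \<open>partial_deriv k \<Phi>\<close>; the second
  differentiates that symmetry for \<open>\<Phi>\<close>, valid throughout \<open>V\<close>.\<close>

lemma third_swap:
  assumes "y \<in> V"
  shows "T i j k y = T j i k y" "T i j k y = T i k j y"
proof -
  show "T i j k y = T j i k y"
    using partial_deriv_commute[OF smooth_on_partial_deriv[OF smooth] open_domain assms] .
  show "T i j k y = T i k j y"
    using partial_deriv_commute[OF smooth open_domain]
    by (intro partial_deriv_cong_open[OF open_domain assms])
qed

lemma partial_deriv_hessian: "y \<in> V \<Longrightarrow> partial_deriv i (\<lambda>z. h z $ j $ k) y = T i j k y"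
  by (intro partial_deriv_cong_open[OF open_domain]) (auto simp: hessian)

lemma levi_civita_hessian:
  assumes "y \<in> V"
  shows "levi_civita h k i j y = (\<Sum>l\<in>UNIV. matrix_inv (h y) $ k $ l * T i j l y) / 2"
proof -
  \<comment> \<open>By total symmetry the three metric derivatives in the Christoffel formula
    coincide, so a single one survives.\<close>
  have "T i j l y + T j i l y - T l i j y = T i j l y" for l
    using third_swap[OF assms] by (metis add_diff_cancel_right')
  then show ?thesis
    by (simp add: levi_civita_def partial_deriv_hessian assms)
qed

text \<open>Lowering the upper index cancels the inverse metric, which leaves a right-hand side that
  is easy to differentiate.\<close>

lemma lowered_levi_civita:
  assumes "y \<in> V"
  shows "(\<Sum>l\<in>UNIV. h y $ p $ l * levi_civita h l i j y) = T i j p y / 2"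
proof -
  have "(\<Sum>l\<in>UNIV. h y $ p $ l * levi_civita h l i j y)
      = (\<Sum>l\<in>UNIV. \<Sum>m\<in>UNIV. h y $ p $ l * matrix_inv (h y) $ l $ m * T i j m y) / 2"
    by (simp add: levi_civita_hessian assms sum_distrib_left sum_divide_distrib mult.assoc)
  also have "\<dots> = (\<Sum>m\<in>UNIV. (h y ** matrix_inv (h y)) $ p $ m * T i j m y) / 2"
    by (subst sum.swap) (simp add: matrix_matrix_mult_def sum_distrib_right)
  also have "\<dots> = T i j p y / 2"
    by (simp add: matrix_mult_matrix_inv invertible_hessian assms mat_def if_distrib[of "\<lambda>u. u * _"] cong: if_cong)
  finally show ?thesis .
qed

lemma has_derivative_hessian_line:
  assumes "y \<in> V"
  shows "((\<lambda>t. h (y + t *\<^sub>R axis i 1) $ j $ k) has_real_derivative T i j k y) (at 0)"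
proof -
  have "((\<lambda>t. partial_deriv j (partial_deriv k \<Phi>) (y + t *\<^sub>R axis i 1)) has_real_derivative T i j k y) (at 0)"
    using has_real_derivative_partial_deriv[of "partial_deriv j (partial_deriv k \<Phi>)" y 0 i]
      smooth_on_imp_differentiable_at[OF smooth_on_partial_deriv[OF smooth_on_partial_deriv[OF smooth]] open_domain assms]
    by simp
  moreover have "\<forall>\<^sub>F t in nhds 0. partial_deriv j (partial_deriv k \<Phi>) (y + t *\<^sub>R axis i 1) = h (y + t *\<^sub>R axis i 1) $ j $ k"
    using eventually_line_in_open[OF open_domain assms, of "axis i 1"]
    by eventually_elim (simp add: hessian)
  ultimately show ?thesis
    by (rule iffD1[OF DERIV_cong_ev[OF refl _ refl], rotated])
qed

lemma has_derivative_third_line: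
  assumes "y \<in> V"
  shows "((\<lambda>t. T j k m (y + t *\<^sub>R axis i 1)) has_real_derivative partial_deriv i (T j k m) y) (at 0)"
proof -
  have "T j k m differentiable at y"
    by (intro smooth_on_imp_differentiable_at[OF _ open_domain assms] smooth_on_partial_deriv smooth)
  then show ?thesis
    using has_real_derivative_partial_deriv[of "T j k m" y 0 i] by simp
qed

text \<open>Near \<open>y\<close> each symbol is built from entries of the inverse metric and third
  derivatives of \<open>\<Phi>\<close>, all differentiable along the line. The product rule needs
  only this existence; the value stays implicit.\<close>

lemma has_derivative_levi_civita_line:
  assumes "y \<in> V"
  shows "((\<lambda>t. levi_civita h l j k (y + t *\<^sub>R axis i 1)) has_real_derivative
    partial_deriv i (levi_civita h l j k) y) (at 0)"
proof -
  have "(\<lambda>t. matrix_inv (h (y + t *\<^sub>R axis i 1)) $ l $ m) field_differentiable at 0" for m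
  proof (rule field_differentiable_matrix_inv)
    show "\<forall>\<^sub>F t in nhds 0. invertible (h (y + t *\<^sub>R axis i 1))"
      using eventually_line_in_open[OF open_domain assms] by eventually_elim (rule invertible_hessian)
  qed (use has_derivative_hessian_line[OF assms] field_differentiable_def in blast)
  moreover have "(\<lambda>t. T j k m (y + t *\<^sub>R axis i 1)) field_differentiable at 0" for m
    unfolding field_differentiable_def using has_derivative_third_line[OF assms] by (rule exI)
  ultimately have "(\<lambda>t. (\<Sum>m\<in>UNIV. matrix_inv (h (y + t *\<^sub>R axis i 1)) $ l $ m * T j k m (y + t *\<^sub>R axis i 1)) / 2)
      field_differentiable at 0"
    by (intro field_differentiable_divide field_differentiable_sum field_differentiable_mult field_differentiable_const) auto
  moreover have "\<forall>\<^sub>F t in nhds 0. levi_civita h l j k (y + t *\<^sub>R axis i 1) =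
      (\<Sum>m\<in>UNIV. matrix_inv (h (y + t *\<^sub>R axis i 1)) $ l $ m * T j k m (y + t *\<^sub>R axis i 1)) / 2"
    using eventually_line_in_open[OF open_domain assms] by eventually_elim (rule levi_civita_hessian)
  ultimately have "(\<lambda>t. levi_civita h l j k (y + t *\<^sub>R axis i 1)) field_differentiable at 0"
    by (rule iffD2[OF field_differentiable_cong_ev, rotated])
  then show ?thesis
    unfolding partial_deriv_def by (simp add: DERIV_deriv_iff_field_differentiable)
qed

text \<open>The product rule is applied to \<open>lowered_levi_civita\<close>; the subtracted sum
  comes from differentiating the metric factor.\<close>

lemma lowered_deriv_levi_civita:
  assumes "y \<in> V"
  shows "(\<Sum>l\<in>UNIV. h y $ p $ l * partial_deriv i (levi_civita h l j k) y) =
    partial_deriv i (T j k p) y / 2 - (\<Sum>l\<in>UNIV. T i p l y * levi_civita h l j k y)"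
proof -
  let ?z = "\<lambda>t. y + t *\<^sub>R axis i 1"
  have lhs: "((\<lambda>t. \<Sum>l\<in>UNIV. h (?z t) $ p $ l * levi_civita h l j k (?z t)) has_real_derivative
      (\<Sum>l\<in>UNIV. T i p l y * levi_civita h l j k y + h y $ p $ l * partial_deriv i (levi_civita h l j k) y)) (at 0)"
    by (auto intro!: derivative_eq_intros has_derivative_hessian_line[OF assms]
        has_derivative_levi_civita_line[OF assms] sum.cong)
  have rhs: "((\<lambda>t. T j k p (?z t) / 2) has_real_derivative partial_deriv i (T j k p) y / 2) (at 0)"
    by (intro DERIV_cdivide has_derivative_third_line[OF assms])
  have eq: "\<forall>\<^sub>F t in nhds 0. (\<Sum>l\<in>UNIV. h (?z t) $ p $ l * levi_civita h l j k (?z t)) = T j k p (?z t) / 2"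
    using eventually_line_in_open[OF open_domain assms] by eventually_elim (rule lowered_levi_civita)
  have "(\<Sum>l\<in>UNIV. T i p l y * levi_civita h l j k y + h y $ p $ l * partial_deriv i (levi_civita h l j k) y)
      = partial_deriv i (T j k p) y / 2"
    by (rule DERIV_unique[OF lhs iffD2[OF DERIV_cong_ev[OF refl eq refl] rhs]])
  then show ?thesis
    by (simp add: sum.distrib)
qed

text \<open>Lowering acts on the first symbol and gives \<open>T i m p y / 2\<close>; swapping
  \<open>m\<close> and \<open>p\<close> yields half of the sum subtracted in
  \<open>lowered_deriv_levi_civita\<close>.\<close>

lemma lowered_quadratic_levi_civita:
  assumes "y \<in> V"
  shows "(\<Sum>l\<in>UNIV. h y $ p $ l * (\<Sum>m\<in>UNIV. levi_civita h l i m y * levi_civita h m j k y))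
    = (\<Sum>m\<in>UNIV. T i p m y * levi_civita h m j k y) / 2"
proof -
  have "(\<Sum>l\<in>UNIV. h y $ p $ l * (\<Sum>m\<in>UNIV. levi_civita h l i m y * levi_civita h m j k y))
      = (\<Sum>m\<in>UNIV. (\<Sum>l\<in>UNIV. h y $ p $ l * levi_civita h l i m y) * levi_civita h m j k y)"
    unfolding sum_distrib_left sum_distrib_right by (subst sum.swap) (simp add: mult.assoc)
  also have "\<dots> = (\<Sum>m\<in>UNIV. T i p m y * levi_civita h m j k y) / 2"
    using third_swap(2)[OF assms] by (simp add: lowered_levi_civita assms sum_divide_distrib)
  finally show ?thesis .
qed

lemma contraction_levi_civita:
  assumes "y \<in> V"
  shows "(\<Sum>m\<in>UNIV. T i p m y * levi_civita h m j k y) =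
    (\<Sum>e\<in>UNIV. \<Sum>f\<in>UNIV. T i p e y * matrix_inv (h y) $ e $ f * T f j k y) / 2"
proof -
  \<comment> \<open>Moves the contracted index to the front, as in the Associativity
    Equation.\<close>
  have "T j k f y = T f j k y" for f
    using third_swap[OF assms] by metis
  then show ?thesis
    by (simp add: levi_civita_hessian assms sum_distrib_left sum_divide_distrib mult.assoc)
qed

text \<open>The contraction of \<open>T\<close> with a symbol has coefficient -1 from the derivative
  and 1/2 from the quadratic term, and the symbol itself contributes another 1/2. This gives -1/4,
  and 1/4 after exchanging \<open>i\<close> and \<open>j\<close>.\<close>

lemma lowered_curvature:
  assumes "y \<in> V"
  shows "(\<Sum>l\<in>UNIV. h y $ p $ l * curvature (levi_civita h) l k i j y) =
    ((\<Sum>e\<in>UNIV. \<Sum>f\<in>UNIV. T j p e y * matrix_inv (h y) $ e $ f * T f i k y) -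
     (\<Sum>e\<in>UNIV. \<Sum>f\<in>UNIV. T i p e y * matrix_inv (h y) $ e $ f * T f j k y)) / 4"
proof -
  \<comment> \<open>Here \<open>i\<close> and \<open>j\<close> are the two outermost derivatives,
    acting on a second derivative of \<open>\<Phi>\<close>.\<close>
  have fourth: "partial_deriv i (T j k p) y = partial_deriv j (T i k p) y"
    by (intro partial_deriv_commute[OF _ open_domain assms] smooth_on_partial_deriv smooth)
  have "(\<Sum>l\<in>UNIV. h y $ p $ l * curvature (levi_civita h) l k i j y) =
      (\<Sum>l\<in>UNIV. h y $ p $ l * partial_deriv i (levi_civita h l j k) y) -
      (\<Sum>l\<in>UNIV. h y $ p $ l * partial_deriv j (levi_civita h l i k) y) +
      (\<Sum>l\<in>UNIV. h y $ p $ l * (\<Sum>m\<in>UNIV. levi_civita h l i m y * levi_civita h m j k y)) -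
      (\<Sum>l\<in>UNIV. h y $ p $ l * (\<Sum>m\<in>UNIV. levi_civita h l j m y * levi_civita h m i k y))"
    unfolding curvature_def by (simp add: sum.distrib sum_subtractf algebra_simps)
  then show ?thesis
    by (simp add: lowered_deriv_levi_civita lowered_quadratic_levi_civita contraction_levi_civita assms fourth)
qed

end

section \<open>The Associativity Equation on a flat Hessian manifold\<close>

theorem lemma2p5p1:
  fixes M :: "'m topology"
    and A :: "('m, 'n::finite) chart set"
    and g :: "('m, 'n) chart \<Rightarrow> real ^ 'n \<Rightarrow> real ^ 'n ^ 'n"
    and \<Gamma> :: "('m, 'n) chart \<Rightarrow> 'n christoffel"
    and \<phi> :: "('m, 'n) chart"
    and V :: "(real ^ 'n) set"
    and \<Phi> :: "real ^ 'n \<Rightarrow> real"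
    and x :: "real ^ 'n"
    and a b c d :: 'n
  assumes "hessian_manifold M A g \<Gamma>"
    and "riemannian_flat A g"
    and "\<phi> \<in> A" and "affine_coordinates \<Gamma> \<phi>"
    and "local_potential g \<phi> V \<Phi>"
    and "x \<in> V"
  shows "(\<Sum>e\<in>UNIV. \<Sum>f\<in>UNIV.
            partial_deriv a (partial_deriv b (partial_deriv e \<Phi>)) x *
            matrix_inv (g \<phi> x) $ e $ f *
            partial_deriv f (partial_deriv c (partial_deriv d \<Phi>)) x) =
         (\<Sum>e\<in>UNIV. \<Sum>f\<in>UNIV.
            partial_deriv b (partial_deriv c (partial_deriv e \<Phi>)) x *
            matrix_inv (g \<phi> x) $ e $ f *
            partial_deriv f (partial_deriv a (partial_deriv d \<Phi>)) x)"
proof -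
  have chart: "open V" "V \<subseteq> chart_image \<phi>" "smooth_on V \<Phi>"
    "\<And>y i j. y \<in> V \<Longrightarrow> g \<phi> y $ i $ j = partial_deriv i (partial_deriv j \<Phi>) y"
    using assms(5) by (auto simp: local_potential_def)
  have "invertible (g \<phi> y)" if "y \<in> V" for y
    using assms(1,3) chart(2) that
    by (intro positive_definite_invertible) (auto simp: hessian_manifold_def riemannian_metric_def)
  then interpret hessian_potential V \<Phi> "g \<phi>"
    using chart by unfold_locales auto
  have "curvature (levi_civita (g \<phi>)) l d c a x = 0" for l
    using assms(2,3,6) chart(2) by (auto simp: riemannian_flat_def flat_connection_def)
  \<comment> \<open>The choice \<open>p = b\<close>, \<open>k = d\<close>, \<open>i = c\<close>,
    \<open>j = a\<close> turns the two contractions into the two sides of the equation, up to the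
    order of \<open>c\<close> and \<open>b\<close> in the second.\<close>
  with lowered_curvature[OF assms(6), of b d c a] have
    "(\<Sum>e\<in>UNIV. \<Sum>f\<in>UNIV. T a b e x * matrix_inv (g \<phi> x) $ e $ f * T f c d x) =
     (\<Sum>e\<in>UNIV. \<Sum>f\<in>UNIV. T c b e x * matrix_inv (g \<phi> x) $ e $ f * T f a d x)"
    by simp
  then show ?thesis
    by (simp add: third_swap(1)[OF assms(6), of c b])
qed

end
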